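(* Let $G=(V,E)$ be a connected amply regular graph with parameters $(n,d,\alpha,\beta)$ (with $n=\infty$ allowed), neither complete nor empty. (i) If $2d(\beta-2)\ge\alpha^2$, then $\mathrm{diam}(G)\le\left\lfloor\dfrac{2d}{2+\frac{\alpha}{2}}\right\rfloor$. (ii) If $2d(\beta-2)\ge\alpha^2-\alpha\beta$, then $\mathrm{diam}(G)\le d$.
   Context: All graphs are simple and undirected. An amply regular graph with parameters $(n,d,\alpha,\beta)$ is a $d$-regular graph ($d$ finite) with $n$ vertices, $n=\infty$ being allowed, such that any two adjacent vertices have exactly $\alpha$ common neighbors and any two vertices at distance $2$ have exactly $\beta$ common neighbors. The diameter is taken with respect to the combinatorial (shortest path) distance. *)

theory Defs
  imports "Graph_Theory.Graph_Theory" "HOL-Library.Extended_Nat"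
begin

text \<open>
  A simple undirected graph, possibly infinite, is a symmetric loop-free relation on a vertex set,
  i.e. a \<open>pair_bidirected_digraph\<close>. (The library locales \<open>graph\<close> and \<open>pair_graph\<close> impose finiteness.)
\<close>

definition num_verts :: "'a pair_pre_digraph \<Rightarrow> enat" where
  "num_verts G = (if finite (pverts G) then enat (card (pverts G)) else \<infinity>)"

definition neighbors :: "'a pair_pre_digraph \<Rightarrow> 'a \<Rightarrow> 'a set" where
  "neighbors G v = {w. (v, w) \<in> parcs G}"

text \<open>
  With unit weights the cost of a walk is its length, so \<open>\<mu>\<close> is the length of a shortest walk
  (\<open>\<infinity>\<close> if there is none).
\<close>

definition graph_dist :: "'a pair_pre_digraph \<Rightarrow> 'a \<Rightarrow> 'a \<Rightarrow> ereal" where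
  "graph_dist G u v = wf_digraph.\<mu> (with_proj G) (\<lambda>_. 1) u v"

definition diameter :: "'a pair_pre_digraph \<Rightarrow> ereal" where
  "diameter G = (SUP (u, v) \<in> pverts G \<times> pverts G. graph_dist G u v)"

definition complete_graph :: "'a pair_pre_digraph \<Rightarrow> bool" where
  "complete_graph G \<longleftrightarrow> (\<forall>u\<in>pverts G. \<forall>v\<in>pverts G. u \<noteq> v \<longrightarrow> (u, v) \<in> parcs G)"

definition empty_graph :: "'a pair_pre_digraph \<Rightarrow> bool" where
  "empty_graph G \<longleftrightarrow> parcs G = {}"

text \<open>
  Finiteness of the neighborhoods is required explicitly because \<open>card\<close> is \<open>0\<close> on infinite sets.
\<close>

locale amply_regular_graph = pair_bidirected_digraph G
  for G :: "'a pair_pre_digraph" +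
  fixes n :: enat and d \<alpha> \<beta> :: nat
  assumes num_verts: "num_verts G = n"
    and regular: "v \<in> pverts G \<Longrightarrow> finite (neighbors G v) \<and> card (neighbors G v) = d"
    and adjacent_common: "(u, v) \<in> parcs G \<Longrightarrow> card (neighbors G u \<inter> neighbors G v) = \<alpha>"
    and distance_2_common: "\<lbrakk>u \<in> pverts G; v \<in> pverts G; graph_dist G u v = 2\<rbrakk>
      \<Longrightarrow> card (neighbors G u \<inter> neighbors G v) = \<beta>"

end

theory Submission
  imports Defs "HOL-Analysis.Convex"
begin

text \<open>
  Each hypothesis makes the Bakry-Emery curvature of the graph at least \<open>K\<close>, with \<open>K = 2 + \<alpha> / 2\<close>
  in (i) and \<open>K = 2\<close> in (ii), and curvature at least \<open>K > 0\<close> forces the diameter to be at most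
  \<open>2 * d / K\<close>. For the latter one compares functions of bounded gradient (among them the distance
  from a vertex) with a small explicit Euler step of the heat equation: since the step contracts
  gradients and moves values by a controlled amount, the largest possible difference of values at
  two vertices is bounded. Only suprema over functions occur, so the graph may be infinite and no
  heat semigroup is needed.
\<close>

text \<open>As \<open>d\<close> is a natural number, it is \<open>0\<close> or at least
  \<open>1\<close>, so \<open>real d\<close> is at most its square.\<close>

lemma abs_le_of_power2_le:
  fixes a :: real
  assumes "a\<^sup>2 \<le> real d"
  shows "\<bar>a\<bar> \<le> real d"
proof (cases "d = 0")
  case False
  then have "real d \<le> (real d)\<^sup>2" by (intro self_le_power) auto
  with assms have "a\<^sup>2 \<le> (real d)\<^sup>2" by linarith
  then show ?thesis by (metis abs_le_square_iff abs_of_nat)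
qed (use assms in auto)

subsection \<open>Distances\<close>

context pair_bidirected_digraph
begin

lemma arc_sym: "(u, v) \<in> parcs G \<longleftrightarrow> (v, u) \<in> parcs G"
  using pair_sym_arcs by (auto simp: symmetric_def sym_def)

lemma neighbors_iff [simp]: "w \<in> neighbors G v \<longleftrightarrow> (v, w) \<in> parcs G"
  by (simp add: neighbors_def)

lemma awalk_cost_one [simp]: "awalk_cost (\<lambda>_. 1) p = real (length p)"
  by (induction p) auto

lemma graph_dist_le: "awalk u p v \<Longrightarrow> graph_dist G u v \<le> ereal (length p)"
  unfolding graph_dist_def using min_cost_le_walk_cost[of u p v "\<lambda>_. 1"] by simp

lemma graph_dist_ge:
  assumes "\<And>p. awalk u p v \<Longrightarrow> k \<le> length p"
  shows "ereal (real k) \<le> graph_dist G u v"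
  unfolding graph_dist_def \<mu>_def by (rule INF_greatest) (use assms in simp)

text \<open>A natural-number version of \<open>graph_dist\<close>. \<open>LEAST\<close> is
  unspecified when there is no walk, so the lemmas about it assume one.\<close>

definition min_walk_length :: "'a \<Rightarrow> 'a \<Rightarrow> nat" where
  "min_walk_length u v = (LEAST k. \<exists>p. awalk u p v \<and> length p = k)"

lemma min_walk_length_le: "awalk u p v \<Longrightarrow> min_walk_length u v \<le> length p"
  unfolding min_walk_length_def by (intro Least_le) auto

lemma min_walk_length_walk:
  assumes "awalk u q v"
  shows "\<exists>p. awalk u p v \<and> length p = min_walk_length u v"
  using assms LeastI_ex[of "\<lambda>k. \<exists>p. awalk u p v \<and> length p = k"]
  unfolding min_walk_length_def by blast

lemma graph_dist_eq_min_walk_length: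
  assumes "awalk u q v"
  shows "graph_dist G u v = ereal (real (min_walk_length u v))"
proof (rule antisym)
  obtain p where "awalk u p v" "length p = min_walk_length u v"
    using min_walk_length_walk[OF assms] by blast
  then show "graph_dist G u v \<le> ereal (real (min_walk_length u v))"
    using graph_dist_le by metis
  show "ereal (real (min_walk_length u v)) \<le> graph_dist G u v"
    by (intro graph_dist_ge min_walk_length_le)
qed

lemma min_walk_length_step:
  assumes "awalk x q u" "(u, v) \<in> parcs G"
  shows "min_walk_length x v \<le> min_walk_length x u + 1"
proof -
  obtain p where p: "awalk x p u" "length p = min_walk_length x u"
    using min_walk_length_walk[OF assms(1)] by blast
  have "awalk u [(u, v)] v"
    using assms(2) by (auto simp: awalk_simps dest: in_arcsD2)
  with p(1) have "awalk x (p @ [(u, v)]) v" by (rule awalk_appendI)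
  from min_walk_length_le[OF this] show ?thesis using p(2) by simp
qed

lemma graph_dist_eq_2:
  assumes "(u, z) \<in> parcs G" "(z, v) \<in> parcs G" "u \<noteq> v" "(u, v) \<notin> parcs G"
  shows "graph_dist G u v = 2"
proof (rule antisym)
  have "awalk u [(u, z), (z, v)] v"
    using assms by (auto simp: awalk_simps dest: in_arcsD2)
  from graph_dist_le[OF this] show "graph_dist G u v \<le> 2" by simp
  have "2 \<le> length p" if "awalk u p v" for p
  proof -
    consider "p = []" | e where "p = [e]" | e f r where "p = e # f # r"
      by (metis list.exhaust)
    then show ?thesis
      using that assms by cases (auto simp: awalk_simps)
  qed
  then show "2 \<le> graph_dist G u v" using graph_dist_ge[of u v 2] by simp
qed

lemma connected_imp_awalk:
  assumes "Digraph_Component.connected (with_proj G)" "u \<in> pverts G" "v \<in> pverts G"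
  shows "\<exists>p. awalk u p v"
proof -
  have "Digraph_Component.strongly_connected (with_proj G)"
    using symmetric_connected_imp_strongly_connected[OF pair_sym_arcs assms(1)] .
  then show ?thesis
    using assms(2,3) by (auto simp: strongly_connected_def reachable_awalk)
qed

end


subsection \<open>The gradient contraction\<close>

locale regular_graph = pair_bidirected_digraph G
  for G :: "'a pair_pre_digraph" +
  fixes d :: nat
  assumes finite_neighbors: "v \<in> pverts G \<Longrightarrow> finite (neighbors G v)"
    and card_neighbors: "v \<in> pverts G \<Longrightarrow> card (neighbors G v) = d"
begin

definition laplacian :: "('a \<Rightarrow> real) \<Rightarrow> 'a \<Rightarrow> real" where
  "laplacian g v = (\<Sum>w\<in>neighbors G v. g w - g v)"

definition energy :: "('a \<Rightarrow> real) \<Rightarrow> 'a \<Rightarrow> real" where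
  "energy g v = (\<Sum>w\<in>neighbors G v. (g w - g v)\<^sup>2)"

text \<open>
  In the notation of Bakry and Emery, \<open>energy g = 2 \<Gamma>(g)\<close> and the left-hand side below is
  \<open>4 \<Gamma>\<^sub>2(g)\<close>, so this is the condition \<open>CD(K, \<infinity>)\<close>.
\<close>

definition curvature_bound :: "real \<Rightarrow> bool" where
  "curvature_bound K \<longleftrightarrow> (\<forall>g. \<forall>v\<in>pverts G.
     laplacian (energy g) v
       - 2 * (\<Sum>w\<in>neighbors G v. (g w - g v) * (laplacian g w - laplacian g v))
     \<ge> 2 * K * energy g v)"

text \<open>This normalisation admits every 1-Lipschitz function, since each of the \<open>d\<close>
  neighbors then contributes at most \<open>1\<close>.\<close>

definition unit_gradient :: "('a \<Rightarrow> real) \<Rightarrow> bool" where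
  "unit_gradient g \<longleftrightarrow> (\<forall>v\<in>pverts G. energy g v \<le> real d)"

lemma neighbors_in_verts: "w \<in> neighbors G v \<Longrightarrow> w \<in> pverts G"
  by (auto dest: in_arcsD2)

text \<open>Cauchy-Schwarz over the \<open>d\<close> neighbors. This limits how far the Euler step
  moves a value.\<close>

lemma abs_laplacian_le:
  assumes "unit_gradient g" "v \<in> pverts G"
  shows "\<bar>laplacian g v\<bar> \<le> real d"
proof -
  have "(laplacian g v)\<^sup>2 \<le> (\<Sum>w\<in>neighbors G v. (g w - g v)\<^sup>2) * card (neighbors G v)"
    unfolding laplacian_def
    by (rule sum_squared_le_sum_of_squares)
  also have "\<dots> = energy g v * real d"
    using assms(2) by (simp add: energy_def card_neighbors)
  also have "\<dots> \<le> real d * real d"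
    using assms by (intro mult_right_mono) (auto simp: unit_gradient_def)
  finally have "(laplacian g v)\<^sup>2 \<le> (real d)\<^sup>2"
    by (simp add: power2_eq_square)
  then show ?thesis by (metis abs_le_square_iff abs_of_nat)
qed

lemma unit_gradient_arc_le:
  assumes "unit_gradient g" "(u, v) \<in> parcs G"
  shows "\<bar>g v - g u\<bar> \<le> real d"
proof -
  have u: "u \<in> pverts G" using assms(2) by (rule in_arcsD1)
  have "(g v - g u)\<^sup>2 \<le> energy g u"
    unfolding energy_def
    by (rule member_le_sum) (use assms u finite_neighbors in auto)
  also have "\<dots> \<le> real d" using assms u by (auto simp: unit_gradient_def)
  finally show ?thesis by (rule abs_le_of_power2_le)
qed

text \<open>A crude bound, which serves to make the supremum over all functions of unit gradient
  finite.\<close>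

lemma unit_gradient_walk_le:
  assumes "unit_gradient g" "awalk u p v"
  shows "g v - g u \<le> real d * real (length p)"
  using assms(2)
proof (induction p arbitrary: u)
  case (Cons e p)
  obtain w where e: "e = (u, w)" "(u, w) \<in> parcs G" "awalk w p v"
    using Cons.prems by (cases e) (auto simp: awalk_simps)
  then have "g v - g w \<le> real d * real (length p)" by (intro Cons.IH)
  moreover have "g w - g u \<le> real d"
    using unit_gradient_arc_le[OF assms(1) e(2)] by linarith
  ultimately show ?case by (simp add: algebra_simps)
qed (auto simp: awalk_simps)

lemma energy_step:
  "energy (\<lambda>v. g v + e * h v) v
     = energy g v + 2 * e * (\<Sum>w\<in>neighbors G v. (g w - g v) * (h w - h v)) + e\<^sup>2 * energy h v"
  unfolding energy_def sum_distrib_left sum.distrib[symmetric]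
  by (rule sum.cong) (auto simp: power2_eq_square algebra_simps)

lemma laplacian_eq:
  assumes "v \<in> pverts G"
  shows "laplacian g v = (\<Sum>w\<in>neighbors G v. g w) - real d * g v"
  using assms by (simp add: laplacian_def sum_subtractf card_neighbors)

text \<open>Curvature bounds the linear term of \<open>energy_step\<close>, leaving a combination of
  the energies at \<open>v\<close> and at its neighbors. The bounds on \<open>e\<close> make its
  coefficients nonnegative, so each energy may be replaced by \<open>d\<close>. For the quadratic
  term \<open>abs_laplacian_le\<close> suffices.\<close>

lemma energy_heat_step_le:
  assumes K: "curvature_bound K" and g: "unit_gradient g" and v: "v \<in> pverts G"
    and e: "0 \<le> e" "e * (real d + 2 * K) \<le> 1"
  shows "energy (\<lambda>v. g v + e * laplacian g v) v
    \<le> real d * (1 - 2 * K * e + 4 * (real d)\<^sup>2 * e\<^sup>2)"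
proof -
  let ?N = "neighbors G v"
  define X where "X = (\<Sum>w\<in>?N. (g w - g v) * (laplacian g w - laplacian g v))"
  have "2 * X \<le> laplacian (energy g) v - 2 * K * energy g v"
    using K[unfolded curvature_bound_def, THEN spec, THEN bspec, OF v, of g]
    unfolding X_def by linarith
  then have "e * (2 * X) \<le> e * (laplacian (energy g) v - 2 * K * energy g v)"
    using e by (intro mult_left_mono)
  moreover have "energy (laplacian g) v \<le> real d * (4 * (real d)\<^sup>2)"
  proof -
    have "(laplacian g w - laplacian g v)\<^sup>2 \<le> 4 * (real d)\<^sup>2" if "w \<in> ?N" for w
    proof -
      have "\<bar>laplacian g w - laplacian g v\<bar> \<le> 2 * real d"
        using abs_laplacian_le[OF g v] abs_laplacian_le[OF g neighbors_in_verts[OF that]] by linarith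
      then have "\<bar>laplacian g w - laplacian g v\<bar>\<^sup>2 \<le> (2 * real d)\<^sup>2"
        by (intro power_mono) auto
      then show ?thesis by (simp add: power_mult_distrib)
    qed
    then have "energy (laplacian g) v \<le> of_nat (card ?N) * (4 * (real d)\<^sup>2)"
      unfolding energy_def by (rule sum_bounded_above)
    then show ?thesis using v by (simp add: card_neighbors)
  qed
  then have "e\<^sup>2 * energy (laplacian g) v \<le> e\<^sup>2 * (real d * (4 * (real d)\<^sup>2))"
    by (intro mult_left_mono) auto
  moreover have "energy g v + e * (laplacian (energy g) v - 2 * K * energy g v)
      \<le> real d * (1 - 2 * K * e)"
  proof -
    have "(\<Sum>w\<in>?N. energy g w) \<le> of_nat (card ?N) * real d"
      by (rule sum_bounded_above) (use g neighbors_in_verts in \<open>auto simp: unit_gradient_def\<close>)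
    then have "e * (\<Sum>w\<in>?N. energy g w) \<le> e * (real d * real d)"
      using e v by (intro mult_left_mono) (auto simp: card_neighbors)
    moreover have "(1 - e * (real d + 2 * K)) * energy g v \<le> (1 - e * (real d + 2 * K)) * real d"
      using e g v by (intro mult_left_mono) (auto simp: unit_gradient_def)
    ultimately show ?thesis
      by (simp add: laplacian_eq[OF v] algebra_simps)
  qed
  ultimately show ?thesis
    unfolding energy_step X_def[symmetric] by (simp add: algebra_simps)
qed

text \<open>
  The Euler step \<open>g + e * laplacian g\<close> contracts the gradient by a factor \<open>1 - K * e\<close> to first
  order in \<open>e\<close>, while \<open>\<bar>laplacian g\<bar> \<le> d\<close>. Comparing with the supremum \<open>M\<close> of \<open>g y - g x\<close> over all
  functions \<open>g\<close> of unit gradient gives \<open>M - 2 * d * e \<le> (1 - K * e) * M\<close> up to terms of second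
  order. The factor \<open>s\<close> dominates the square root of the bound of the preceding lemma.
\<close>

lemma unit_gradient_diff_le:
  assumes K: "curvature_bound K" "0 < K" and xy: "x \<in> pverts G" "awalk x p y"
    and f: "unit_gradient f"
  shows "K * (f y - f x) \<le> 2 * real d"
proof -
  let ?F = "{g. unit_gradient g}"
  let ?D = "(\<lambda>g. g y - g x) ` ?F"
  define M where "M = Sup ?D"
  have bdd: "bdd_above ?D"
    using unit_gradient_walk_le[OF _ xy(2)] by (auto simp: bdd_above_def)
  have upper: "g y - g x \<le> M" if "unit_gradient g" for g
    unfolding M_def by (rule cSUP_upper[OF _ bdd]) (use that in auto)
  have y: "y \<in> pverts G" using xy(2) by auto
  have step: "M * (K - 2 * (real d)\<^sup>2 * e) \<le> 2 * real d"
    if e: "0 < e" "e * (real d + 2 * K) \<le> 1" for e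
  proof -
    define s where "s = 1 - K * e + 2 * (real d)\<^sup>2 * e\<^sup>2"
    have "0 \<le> e * real d" "0 < K * e" using e K by simp_all
    moreover have "e * real d + 2 * (K * e) \<le> 1" using e by (simp add: algebra_simps)
    ultimately have "K * e < 1" by linarith
    then have s: "0 < s" by (simp add: s_def add_pos_nonneg)
    \<comment> \<open>If \<open>1 + x\<close> is the factor in \<open>energy_heat_step_le\<close>,
      then \<open>s = 1 + x / 2\<close>, and the last square is that of
      \<open>x / 2\<close>.\<close>
    have "s\<^sup>2 = (1 - 2 * K * e + 4 * (real d)\<^sup>2 * e\<^sup>2) + (K * e - 2 * (real d)\<^sup>2 * e\<^sup>2)\<^sup>2"
      unfolding s_def by (simp add: power2_eq_square algebra_simps)
    then have s2: "1 - 2 * K * e + 4 * (real d)\<^sup>2 * e\<^sup>2 \<le> s\<^sup>2" by simp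
    have bound: "g y - g x \<le> s * M + 2 * real d * e" if g: "unit_gradient g" for g
    proof -
      define h where "h v = g v + e * laplacian g v" for v
      \<comment> \<open>Dividing by \<open>s\<close> makes the Euler step a competitor in the
        supremum \<open>M\<close>.\<close>
      have "unit_gradient (\<lambda>v. h v / s)"
        unfolding unit_gradient_def
      proof
        fix v assume v: "v \<in> pverts G"
        have "energy h v \<le> real d * (1 - 2 * K * e + 4 * (real d)\<^sup>2 * e\<^sup>2)"
          unfolding h_def using energy_heat_step_le[OF K(1) g v] e by simp
        also have "\<dots> \<le> real d * s\<^sup>2" using s2 by (intro mult_left_mono) auto
        finally have "energy h v / s\<^sup>2 \<le> real d" using s by (simp add: divide_simps)
        moreover have "energy (\<lambda>v. h v / s) v = energy h v / s\<^sup>2"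
          unfolding energy_def sum_divide_distrib
          by (simp add: diff_divide_distrib[symmetric] power_divide)
        ultimately show "energy (\<lambda>v. h v / s) v \<le> real d" by simp
      qed
      from upper[OF this] have "(h y - h x) / s \<le> M" by (simp add: diff_divide_distrib)
      then have "h y - h x \<le> s * M" using s by (simp add: divide_simps mult.commute)
      moreover have "laplacian g x - laplacian g y \<le> 2 * real d"
        using abs_laplacian_le[OF g xy(1)] abs_laplacian_le[OF g y] by linarith
      then have "e * (laplacian g x - laplacian g y) \<le> e * (2 * real d)"
        using e by (intro mult_left_mono) auto
      ultimately show ?thesis by (simp add: h_def algebra_simps)
    qed
    have "M \<le> s * M + 2 * real d * e"
      unfolding M_def by (rule cSUP_least) (use f bound in \<open>auto simp: M_def\<close>)
    then have "e * (M * (K - 2 * (real d)\<^sup>2 * e)) \<le> e * (2 * real d)"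
      by (simp add: s_def power2_eq_square algebra_simps)
    then show ?thesis using e(1) by (simp only: mult_le_cancel_left_pos)
  qed
  \<comment> \<open>Letting \<open>e\<close> tend to 0 from the right removes the remaining error
    term.\<close>
  have "((\<lambda>e. M * (K - 2 * (real d)\<^sup>2 * e)) \<longlongrightarrow> M * (K - 2 * (real d)\<^sup>2 * 0)) (at_right 0)"
    by (intro tendsto_intros)
  moreover have "\<forall>\<^sub>F e in at_right 0. M * (K - 2 * (real d)\<^sup>2 * e) \<le> 2 * real d"
    unfolding eventually_at_right_field
  proof (intro exI[of _ "1 / (real d + 2 * K)"] conjI allI impI)
    show "0 < 1 / (real d + 2 * K)" using K by (simp add: add_nonneg_pos)
    fix e assume "0 < e" "e < 1 / (real d + 2 * K)"
    moreover have "0 < real d + 2 * K" using K by (simp add: add_nonneg_pos)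
    ultimately show "M * (K - 2 * (real d)\<^sup>2 * e) \<le> 2 * real d"
      by (intro step) (auto simp: field_simps)
  qed
  ultimately have "M * (K - 2 * (real d)\<^sup>2 * 0) \<le> 2 * real d"
    by (rule tendsto_upperbound) simp
  then have "K * M \<le> 2 * real d" by (simp add: mult.commute)
  moreover have "K * (f y - f x) \<le> K * M"
    using upper[OF f] K by (intro mult_left_mono) auto
  ultimately show ?thesis by linarith
qed

section \<open>From curvature to distances and the diameter\<close>

lemma unit_gradient_min_walk_length:
  assumes "Digraph_Component.connected (with_proj G)" "x \<in> pverts G"
  shows "unit_gradient (\<lambda>v. real (min_walk_length x v))"
  unfolding unit_gradient_def
proof
  let ?f = "\<lambda>v. real (min_walk_length x v)"
  fix v assume v: "v \<in> pverts G"
  have "(?f w - ?f v)\<^sup>2 \<le> 1" if "w \<in> neighbors G v" for w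
  proof -
    have w: "(v, w) \<in> parcs G" "(w, v) \<in> parcs G" "w \<in> pverts G"
      using that arc_sym neighbors_in_verts by auto
    then obtain p q where "awalk x p v" "awalk x q w"
      using connected_imp_awalk[OF assms] v by blast
    then have "min_walk_length x w \<le> min_walk_length x v + 1"
      "min_walk_length x v \<le> min_walk_length x w + 1"
      using min_walk_length_step w by blast+
    then have "\<bar>?f w - ?f v\<bar> \<le> 1" by linarith
    then show ?thesis by (simp add: abs_square_le_1)
  qed
  then have "energy ?f v \<le> of_nat (card (neighbors G v)) * 1"
    unfolding energy_def by (rule sum_bounded_above)
  then show "energy ?f v \<le> real d" using v by (simp add: card_neighbors)
qed

theorem min_walk_length_le_curvature:
  assumes "Digraph_Component.connected (with_proj G)" "x \<in> pverts G" "y \<in> pverts G"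
    and "curvature_bound K" "0 < K"
  shows "real (min_walk_length x y) \<le> 2 * real d / K"
proof -
  obtain p where p: "awalk x p y"
    using connected_imp_awalk assms by blast
  have "min_walk_length x x \<le> length ([] :: ('a \<times> 'a) list)"
    using assms by (intro min_walk_length_le) (simp add: awalk_simps)
  then show ?thesis
    using unit_gradient_diff_le[OF assms(4,5,2) p unit_gradient_min_walk_length[OF assms(1,2)]]
      assms(5) by (simp add: field_simps)
qed

text \<open>Distances are natural numbers, so the floor can be taken for each pair before the
  supremum.\<close>

theorem diameter_le_curvature:
  assumes "Digraph_Component.connected (with_proj G)" "curvature_bound K" "0 < K"
  shows "diameter G \<le> ereal (real_of_int \<lfloor>2 * real d / K\<rfloor>)"
proof -
  have "graph_dist G x y \<le> ereal (real_of_int \<lfloor>2 * real d / K\<rfloor>)"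
    if xy: "x \<in> pverts G" "y \<in> pverts G" for x y
  proof -
    have "int (min_walk_length x y) \<le> \<lfloor>2 * real d / K\<rfloor>"
      using min_walk_length_le_curvature[OF assms(1) xy assms(2,3)] by (simp add: le_floor_iff)
    then have "real (min_walk_length x y) \<le> real_of_int \<lfloor>2 * real d / K\<rfloor>" by linarith
    moreover obtain p where "awalk x p y" using connected_imp_awalk[OF assms(1) xy] by blast
    ultimately show ?thesis by (simp add: graph_dist_eq_min_walk_length)
  qed
  then show ?thesis unfolding diameter_def by (auto intro!: SUP_least)
qed

end

subsection \<open>Curvature of amply regular graphs\<close>

sublocale amply_regular_graph \<subseteq> regular_graph G d
  by unfold_locales (use regular in auto)

context amply_regular_graph
begin

text \<open>The common neighbor \<open>z\<close> leaves two cases for distinct vertices: adjacent or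
  at distance 2.\<close>

lemma common_neighbors_distinct:
  assumes "(u, z) \<in> parcs G" "(z, v) \<in> parcs G" "u \<noteq> v"
  shows "card (neighbors G u \<inter> neighbors G v) = (if (u, v) \<in> parcs G then \<alpha> else \<beta>)"
proof (cases "(u, v) \<in> parcs G")
  case False
  then have "graph_dist G u v = 2" by (rule graph_dist_eq_2[OF assms])
  then show ?thesis
    using False distance_2_common in_arcsD1[OF assms(1)] in_arcsD2[OF assms(2)] by simp
qed (simp add: adjacent_common)

text \<open>
  With \<open>F = g - g y\<close>, the left-hand side of the curvature condition at \<open>y\<close> depends on the values
  of \<open>F\<close> on the second sphere around \<open>y\<close> only through terms
  \<open>\<beta> * (F w)\<^sup>2 - 4 * F w * S w \<ge> - 4 * (S w)\<^sup>2 / \<beta>\<close>, where \<open>S w\<close> sums \<open>F\<close> over the common neighbors of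
  \<open>w\<close> and \<open>y\<close>. The sum of the \<open>(S w)\<^sup>2\<close> over the ball of radius 2 counts common neighbors of pairs of
  neighbors of \<open>y\<close>. What remains is a quadratic form in \<open>F\<close> on the neighborhood of \<open>y\<close> that involves
  only the all-ones matrix and the local adjacency operator \<open>S\<close>, and \<open>S\<close> enters as
  \<open>(S - \<alpha> / 2)\<^sup>2 - \<alpha>\<^sup>2 / 4\<close>.
\<close>

theorem curvature_bound_amply_regular:
  fixes c :: real
  assumes \<beta>: "0 < \<beta>" and c: "0 \<le> c"
    and le: "(real \<alpha>)\<^sup>2 / 2 \<le> real d * (real \<beta> - 2) + real \<beta> * c"
  shows "curvature_bound (2 + real \<alpha> / 2 - c)"
  unfolding curvature_bound_def
proof (intro allI ballI)
  fix g :: "'a \<Rightarrow> real" and y assume y: "y \<in> pverts G"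
  define N where "N = neighbors G y"
  define F where "F v = g v - g y" for v
  define S where "S w = (\<Sum>z\<in>{z\<in>N. (z, w) \<in> parcs G}. F z)" for w
  \<comment> \<open>\<open>B\<close> is the ball and \<open>R\<close> the sphere of radius 2 about
    \<open>y\<close>, both finite even if the graph is not.\<close>
  define B where "B = insert y (N \<union> (\<Union>z\<in>N. neighbors G z))"
  define R where "R = B - insert y N"
  define s where "s = (\<Sum>z\<in>N. F z)"
  define q where "q = (\<Sum>z\<in>N. (F z)\<^sup>2)"
  define p where "p = (\<Sum>z\<in>N. F z * S z)"
  define a where "a = (\<Sum>z\<in>N. (S z)\<^sup>2)"
  define T where "T = (\<Sum>z\<in>N. \<Sum>w\<in>neighbors G z. (F w)\<^sup>2 - 4 * F w * F z)"
  have N: "z \<in> N \<longleftrightarrow> (y, z) \<in> parcs G" for z by (simp add: N_def)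
  have NV: "z \<in> pverts G" if "z \<in> N" for z using that by (auto simp: N dest: in_arcsD2)
  have fN: "finite N" and cN: "card N = d"
    using y by (simp_all add: N_def finite_neighbors card_neighbors)
  have fB: "finite B" unfolding B_def using fN NV finite_neighbors by auto
  have yN: "y \<notin> N" using no_loops' by (auto simp: N)
  have nbB: "neighbors G z = {w \<in> B. (z, w) \<in> parcs G}" if "z \<in> N" for z
    using that by (auto simp: B_def)
  have split_B: "(\<Sum>w\<in>B. h w) = h y + (\<Sum>w\<in>N. h w) + (\<Sum>w\<in>R. h w)" for h :: "'a \<Rightarrow> real"
  proof -
    have "insert y N \<subseteq> B" by (auto simp: B_def)
    from sum.subset_diff[OF this fB, of h] show ?thesis
      using fN yN by (simp add: R_def)
  qed
  \<comment> \<open>Paths \<open>y\<close>, \<open>z\<close>, \<open>w\<close> are grouped by their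
    end \<open>w\<close> instead of their midpoint \<open>z\<close>.\<close>
  have swap_B: "(\<Sum>z\<in>N. \<Sum>w\<in>neighbors G z. h z w)
      = (\<Sum>w\<in>B. \<Sum>z\<in>{z\<in>N. (z, w) \<in> parcs G}. h z w)" for h :: "'a \<Rightarrow> 'a \<Rightarrow> real"
  proof -
    have "(\<Sum>z\<in>N. \<Sum>w\<in>neighbors G z. h z w)
        = (\<Sum>z\<in>N. \<Sum>w\<in>{w \<in> B. (z, w) \<in> parcs G}. h z w)"
      by (rule sum.cong) (simp_all add: nbB)
    then show ?thesis by (simp add: sum.swap_restrict[OF fN fB])
  qed
  have common: "{z \<in> N. (z, w) \<in> parcs G} = neighbors G y \<inter> neighbors G w" for w
    using arc_sym by (auto simp: N)
  have Fy: "F y = 0" by (simp add: F_def)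
  have Sy: "S y = s"
  proof -
    have "{z \<in> N. (z, y) \<in> parcs G} = N" using arc_sym by (auto simp: N)
    then show ?thesis by (simp add: S_def s_def)
  qed
  have card_N: "card {z \<in> N. (z, w) \<in> parcs G} = \<alpha>" if "w \<in> N" for w
    unfolding common using that adjacent_common by (simp add: N)
  have card_R: "card {z \<in> N. (z, w) \<in> parcs G} = \<beta>" if w: "w \<in> R" for w
  proof -
    obtain z where "(y, z) \<in> parcs G" "(z, w) \<in> parcs G" "w \<noteq> y" "(y, w) \<notin> parcs G"
      using w by (auto simp: R_def B_def N)
    then show ?thesis unfolding common by (simp add: common_neighbors_distinct)
  qed

  have expand: "laplacian (energy g) y
      - 2 * (\<Sum>z\<in>neighbors G y. (g z - g y) * (laplacian g z - laplacian g y))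
    = 2 * real d * q + 2 * s\<^sup>2 + T"
  proof -
    have Ly: "laplacian g y = s" by (simp add: laplacian_def s_def N_def F_def)
    have Ey: "energy g y = q" by (simp add: energy_def q_def N_def F_def)
    have z: "energy g z - 2 * F z * laplacian g z
        = 3 * real d * (F z)\<^sup>2 + (\<Sum>w\<in>neighbors G z. (F w)\<^sup>2 - 4 * F w * F z)" if "z \<in> N" for z
    proof -
      have "energy g z - 2 * F z * laplacian g z
          = (\<Sum>w\<in>neighbors G z. (F w - F z)\<^sup>2 - 2 * F z * (F w - F z))"
        unfolding energy_def laplacian_def sum_distrib_left sum_subtractf[symmetric] F_def by simp
      also have "\<dots> = (\<Sum>w\<in>neighbors G z. 3 * (F z)\<^sup>2 + ((F w)\<^sup>2 - 4 * F w * F z))"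
        by (rule sum.cong) (auto simp: power2_eq_square algebra_simps)
      also have "\<dots> = 3 * real d * (F z)\<^sup>2 + (\<Sum>w\<in>neighbors G z. (F w)\<^sup>2 - 4 * F w * F z)"
        unfolding sum.distrib using NV[OF that] by (simp add: card_neighbors)
      finally show ?thesis .
    qed
    have "(\<Sum>z\<in>neighbors G y. (g z - g y) * (laplacian g z - laplacian g y))
        = (\<Sum>z\<in>N. F z * laplacian g z) - s * s"
      unfolding Ly N_def[symmetric] F_def[symmetric] right_diff_distrib sum_subtractf
        sum_distrib_right[symmetric] s_def[symmetric] ..
    moreover have "laplacian (energy g) y = (\<Sum>z\<in>N. energy g z) - real d * q"
      unfolding laplacian_eq[OF y, of "energy g"] Ey N_def ..
    moreover have "(\<Sum>z\<in>N. energy g z - 2 * F z * laplacian g z)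
        = (\<Sum>z\<in>N. energy g z) - 2 * (\<Sum>z\<in>N. F z * laplacian g z)"
      by (simp add: sum_subtractf sum_distrib_left mult.assoc)
    ultimately have "laplacian (energy g) y
        - 2 * (\<Sum>z\<in>neighbors G y. (g z - g y) * (laplacian g z - laplacian g y))
      = (\<Sum>z\<in>N. energy g z - 2 * F z * laplacian g z) - real d * q + 2 * s * s"
      by simp
    also have "\<dots> = 2 * real d * q + 2 * s\<^sup>2 + T"
      by (simp add: z sum.distrib T_def q_def sum_distrib_left[symmetric] power2_eq_square)
    finally show ?thesis .
  qed

  have T_ge: "real \<alpha> * q - 4 * p - 4 / real \<beta> * (\<Sum>w\<in>R. (S w)\<^sup>2) \<le> T"
  proof -
    let ?h = "\<lambda>w. real (card {z \<in> N. (z, w) \<in> parcs G}) * (F w)\<^sup>2 - 4 * F w * S w"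
    have "T = (\<Sum>w\<in>B. ?h w)"
      unfolding T_def swap_B by (simp add: sum_subtractf S_def sum_distrib_left)
    also have "\<dots> = (\<Sum>w\<in>N. ?h w) + (\<Sum>w\<in>R. ?h w)"
      by (simp add: split_B Fy)
    also have "(\<Sum>w\<in>N. ?h w) = real \<alpha> * q - 4 * p"
      by (simp add: card_N sum_subtractf q_def p_def sum_distrib_left mult.assoc)
    finally have T: "T = real \<alpha> * q - 4 * p + (\<Sum>w\<in>R. ?h w)" .
    have "- (4 / real \<beta>) * (S w)\<^sup>2 \<le> ?h w" if "w \<in> R" for w
    proof -
      \<comment> \<open>Completing the square in the free value \<open>F w\<close>, with minimum at
        \<open>F w = 2 * S w / \<beta>\<close>.\<close>
      have "0 \<le> (real \<beta> * F w - 2 * S w)\<^sup>2 / real \<beta>" using \<beta> by simp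
      also have "\<dots> = real \<beta> * (F w)\<^sup>2 - 4 * F w * S w + (4 / real \<beta>) * (S w)\<^sup>2"
        using \<beta> by (simp add: power2_eq_square field_simps)
      finally show ?thesis using that by (simp add: card_R)
    qed
    then have "(\<Sum>w\<in>R. - (4 / real \<beta>) * (S w)\<^sup>2) \<le> (\<Sum>w\<in>R. ?h w)" by (rule sum_mono)
    then show ?thesis unfolding T sum_distrib_left[symmetric] by simp
  qed

  have S_sum: "(\<Sum>w\<in>neighbors G z. S w)
      = real \<beta> * s + (real \<alpha> - real \<beta>) * S z + (real d - real \<beta>) * F z" if z: "z \<in> N" for z
  proof -
    have fz: "finite (neighbors G z)" using z NV finite_neighbors by auto
    have "(\<Sum>w\<in>neighbors G z. S w)
        = (\<Sum>w\<in>neighbors G z. \<Sum>z'\<in>{z'\<in>N. (z', w) \<in> parcs G}. F z')"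
      by (simp add: S_def)
    also have "\<dots> = (\<Sum>z'\<in>N. \<Sum>w\<in>{w\<in>neighbors G z. (z', w) \<in> parcs G}. F z')"
      by (rule sum.swap_restrict[OF fz fN])
    \<comment> \<open>Any two vertices of \<open>N\<close> share the neighbor \<open>y\<close>, so
      the common-neighbor counts on \<open>N\<close> form the matrix
      \<open>\<beta> J + (\<alpha> - \<beta>) A + (d - \<beta>) I\<close>, with \<open>J\<close> all
      ones and \<open>A\<close> the local adjacency.\<close>
    also have "\<dots> = (\<Sum>z'\<in>N. real \<beta> * F z' + (real \<alpha> - real \<beta>) * (if (z', z) \<in> parcs G then F z' else 0)
        + (if z' = z then (real d - real \<beta>) * F z' else 0))"
    proof (rule sum.cong[OF refl])
      fix z' assume z': "z' \<in> N"
      have *: "{w\<in>neighbors G z. (z', w) \<in> parcs G} = neighbors G z' \<inter> neighbors G z" by auto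
      have "card (neighbors G z' \<inter> neighbors G z)
          = (if z' = z then d else if (z', z) \<in> parcs G then \<alpha> else \<beta>)"
        using z z' NV card_neighbors common_neighbors_distinct[of z' y z] arc_sym by (auto simp: N)
      then show "(\<Sum>w\<in>{w\<in>neighbors G z. (z', w) \<in> parcs G}. F z')
          = real \<beta> * F z' + (real \<alpha> - real \<beta>) * (if (z', z) \<in> parcs G then F z' else 0)
            + (if z' = z then (real d - real \<beta>) * F z' else 0)"
        unfolding * using no_loops' by (auto simp: algebra_simps)
    qed
    also have "\<dots> = real \<beta> * s + (real \<alpha> - real \<beta>) * S z + (real d - real \<beta>) * F z"
      using fN z by (simp add: sum.distrib s_def S_def sum_distrib_left sum.inter_filter)
    finally show ?thesis .
  qed

  have R_sum: "(\<Sum>w\<in>R. (S w)\<^sup>2)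
      = (real \<beta> - 1) * s\<^sup>2 + (real \<alpha> - real \<beta>) * p + (real d - real \<beta>) * q - a"
  proof -
    have "s\<^sup>2 + a + (\<Sum>w\<in>R. (S w)\<^sup>2) = (\<Sum>w\<in>B. (S w)\<^sup>2)"
      by (simp add: split_B Sy a_def)
    also have "\<dots> = (\<Sum>w\<in>B. \<Sum>z\<in>{z\<in>N. (z, w) \<in> parcs G}. F z * S w)"
      by (simp add: S_def power2_eq_square sum_distrib_right)
    also have "\<dots> = (\<Sum>z\<in>N. F z * (\<Sum>w\<in>neighbors G z. S w))"
      by (simp add: swap_B[symmetric] sum_distrib_left)
    also have "\<dots> = (\<Sum>z\<in>N. real \<beta> * s * F z + (real \<alpha> - real \<beta>) * (F z * S z)
        + (real d - real \<beta>) * (F z)\<^sup>2)"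
      by (rule sum.cong) (auto simp: S_sum power2_eq_square algebra_simps)
    also have "\<dots> = real \<beta> * s * s + (real \<alpha> - real \<beta>) * p + (real d - real \<beta>) * q"
      by (simp add: sum.distrib s_def p_def q_def sum_distrib_left)
    finally show ?thesis by (simp add: power2_eq_square algebra_simps)
  qed

  have S_total: "(\<Sum>z\<in>N. S z) = real \<alpha> * s"
  proof -
    have "(\<Sum>z\<in>N. S z) = (\<Sum>z'\<in>N. \<Sum>z\<in>{z\<in>N. (z', z) \<in> parcs G}. F z')"
      unfolding S_def by (rule sum.swap_restrict[OF fN fN])
    also have "\<dots> = (\<Sum>z'\<in>N. real \<alpha> * F z')"
      using card_N arc_sym by (intro sum.cong) simp_all
    finally show ?thesis by (simp add: s_def sum_distrib_left)
  qed

  show "2 * (2 + real \<alpha> / 2 - c) * energy g y \<le> laplacian (energy g) y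
      - 2 * (\<Sum>z\<in>neighbors G y. (g z - g y) * (laplacian g z - laplacian g y))"
  proof (cases "d = 0")
    case True
    then have "neighbors G y = {}" using fN cN by (simp add: N_def)
    then show ?thesis by (simp add: energy_def laplacian_def)
  next
    case False
    \<comment> \<open>\<open>v\<close> is the squared norm of \<open>F\<close> on \<open>N\<close>
      after its mean is removed.\<close>
    define v where "v = q - s\<^sup>2 / real d"
    have "s\<^sup>2 \<le> q * real d"
      unfolding s_def q_def cN[symmetric] by (rule sum_squared_le_sum_of_squares)
    then have v: "0 \<le> v" "v \<le> q" using False by (simp_all add: v_def field_simps)
    have square: "- (real \<alpha>)\<^sup>2 / 4 * v \<le> a - real \<alpha> * p"
    proof -
      \<comment> \<open>By \<open>S_total\<close>, \<open>t\<close> is the mean of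
        \<open>S z - \<alpha> / 2 * F z\<close> over \<open>N\<close>. Subtracting it yields
        \<open>v\<close> in place of the larger \<open>q\<close>.\<close>
      define t where "t = real \<alpha> * s / (2 * real d)"
      have "0 \<le> (\<Sum>z\<in>N. (S z - real \<alpha> / 2 * F z - t)\<^sup>2)" by (intro sum_nonneg) simp
      also have "\<dots> = (\<Sum>z\<in>N. (S z)\<^sup>2 - real \<alpha> * (F z * S z) + (real \<alpha>)\<^sup>2 / 4 * (F z)\<^sup>2
          - 2 * t * S z + real \<alpha> * t * F z + t\<^sup>2)"
        by (rule sum.cong) (auto simp: power2_eq_square algebra_simps)
      also have "\<dots> = a - real \<alpha> * p + (real \<alpha>)\<^sup>2 / 4 * q - 2 * t * (real \<alpha> * s)
          + real \<alpha> * t * s + real d * t\<^sup>2"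
        unfolding a_def p_def q_def sum.distrib sum_subtractf sum_distrib_left[symmetric]
          S_total s_def[symmetric] by (simp add: cN)
      also have "\<dots> = a - real \<alpha> * p + (real \<alpha>)\<^sup>2 / 4 * v"
        using False by (simp add: t_def v_def power2_eq_square field_simps)
      finally show ?thesis by simp
    qed
    have ds: "real d * q - s\<^sup>2 = real d * v" using False by (simp add: v_def field_simps)
    \<comment> \<open>The hypothesis is multiplied by \<open>v\<close>; the term with
      \<open>c\<close> is then enlarged from \<open>v\<close> to \<open>q\<close>.\<close>
    have "0 \<le> (real d * (real \<beta> - 2) + real \<beta> * c - (real \<alpha>)\<^sup>2 / 2) * v"
      using le v by (intro mult_nonneg_nonneg) auto
    also have "\<dots> \<le> (real \<beta> - 2) * (real d * q - s\<^sup>2) + 2 * (a - real \<alpha> * p) + real \<beta> * c * v"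
      unfolding ds using square by (simp add: algebra_simps)
    also have "\<dots> \<le> (real \<beta> - 2) * (real d * q - s\<^sup>2) + 2 * (a - real \<alpha> * p) + real \<beta> * c * q"
      using v c by (intro add_left_mono mult_left_mono) auto
    finally have "0 \<le> 2 / real \<beta> * \<dots>" using \<beta> by simp
    also have "\<dots> = 2 * real d * q + 2 * s\<^sup>2
        + (real \<alpha> * q - 4 * p - 4 / real \<beta> * (\<Sum>w\<in>R. (S w)\<^sup>2)) - 2 * (2 + real \<alpha> / 2 - c) * q"
      using \<beta> unfolding R_sum by (simp add: field_simps)
    also have "\<dots> \<le> 2 * real d * q + 2 * s\<^sup>2 + T - 2 * (2 + real \<alpha> / 2 - c) * q"
      using T_ge by simp
    finally show ?thesis
      unfolding expand by (simp add: energy_def q_def N_def F_def)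
  qed
qed

end

section \<open>The two diameter bounds, from \<open>c = 0\<close> and
  \<open>c = \<alpha> / 2\<close>\<close>

theorem corollary4p6:
  fixes G :: "'a pair_pre_digraph" and n :: enat and d \<alpha> \<beta> :: nat
  assumes "amply_regular_graph G n d \<alpha> \<beta>"
    and "Digraph_Component.connected (with_proj G)"
    and "\<not> complete_graph G"
    and "\<not> empty_graph G"
  shows "(2 * int d * (int \<beta> - 2) \<ge> (int \<alpha>)^2 \<longrightarrow>
           diameter G \<le> ereal (real_of_int \<lfloor>2 * real d / (2 + real \<alpha> / 2)\<rfloor>))
       \<and> (2 * int d * (int \<beta> - 2) \<ge> (int \<alpha>)^2 - int \<alpha> * int \<beta> \<longrightarrow>
           diameter G \<le> ereal (real d))"
proof -
  interpret amply_regular_graph G n d \<alpha> \<beta> by fact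
  obtain u v where "(u, v) \<in> parcs G" using assms(4) by (auto simp: empty_graph_def)
  then have "v \<in> neighbors G u" "u \<in> pverts G" by (auto dest: in_arcsD1)
  \<comment> \<open>In both cases below, \<open>0 < d\<close> is what forces \<open>\<beta>\<close>
    to be positive.\<close>
  then have d: "0 < d"
    using finite_neighbors card_neighbors by (metis card_gt_0_iff empty_iff)
  have cast: "2 * real d * (real \<beta> - 2) = real_of_int (2 * int d * (int \<beta> - 2))" by simp
  show ?thesis
  proof (intro conjI impI)
    assume le: "2 * int d * (int \<beta> - 2) \<ge> (int \<alpha>)^2"
    then have "0 \<le> 2 * int d * (int \<beta> - 2)" by (rule order_trans[rotated]) simp
    then have \<beta>: "0 < \<beta>" using d by (simp add: zero_le_mult_iff)
    have "(real \<alpha>)\<^sup>2 \<le> 2 * real d * (real \<beta> - 2)"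
      unfolding cast using le by (metis of_int_le_iff of_int_of_nat_eq of_int_power)
    then have "curvature_bound (2 + real \<alpha> / 2 - 0)"
      using \<beta> by (intro curvature_bound_amply_regular) auto
    then show "diameter G \<le> ereal (real_of_int \<lfloor>2 * real d / (2 + real \<alpha> / 2)\<rfloor>)"
      using diameter_le_curvature[OF assms(2), of "2 + real \<alpha> / 2"] by (simp add: add_pos_nonneg)
  next
    assume le: "2 * int d * (int \<beta> - 2) \<ge> (int \<alpha>)^2 - int \<alpha> * int \<beta>"
    have \<beta>: "0 < \<beta>"
    proof (rule ccontr)
      assume "\<not> 0 < \<beta>"
      then have "(int \<alpha>)\<^sup>2 + 4 * int d \<le> 0" using le by simp
      moreover have "0 \<le> (int \<alpha>)\<^sup>2" by simp
      ultimately show False using d by linarith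
    qed
    have "real_of_int ((int \<alpha>)\<^sup>2 - int \<alpha> * int \<beta>) \<le> 2 * real d * (real \<beta> - 2)"
      unfolding cast using le by (simp only: of_int_le_iff)
    \<comment> \<open>Taking \<open>c = \<alpha> / 2\<close> lowers the curvature to 2 and accounts
      for the term \<open>\<alpha> * \<beta>\<close> in the hypothesis.\<close>
    then have "curvature_bound (2 + real \<alpha> / 2 - real \<alpha> / 2)"
      using \<beta> by (intro curvature_bound_amply_regular) (auto simp: algebra_simps)
    then show "diameter G \<le> ereal (real d)"
      using diameter_le_curvature[OF assms(2), of 2] by simp
  qed
qed

end
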